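(* For every real Banach space $X$ with $\dim X\ge2$ and every $-\infty\le t<\infty$, $$1\le C^B_t(X)\le 2.$$ Moreover: (1) $J^B_{X,t}(0)=1$ and $1\le J^B_{X,t}(\tau)\le 1+\tau$ for $0\le\tau\le1$; (2) if $-\infty\le s\le t<\infty$, then $J^B_{X,s}(\tau)\le J^B_{X,t}(\tau)$ for every $\tau\ge0$, and consequently $C^B_s(X)\le C^B_t(X)$; (3) if $Y$ is a closed subspace of $X$ with $\dim Y\ge2$, then $C^B_t(Y)\le C^B_t(X)$; (4) $C^B_t(X)\le C_t(X)$, where $C_t(X)$ is Takahashi's unrestricted constant.
   Context: $S_X$ denotes the unit sphere of $X$. For $x,y\in X$, Birkhoff-James orthogonality $x\perp_B y$ means $\|x+\lambda y\|\ge\|x\|$ for all $\lambda\in\mathbb{R}$. For $a,b>0$ set $M_t(a,b)=\left(\frac{a^t+b^t}{2}\right)^{1/t}$ if $t\in\mathbb{R}\setminus\{0\}$, $M_0(a,b)=\sqrt{ab}$, and $M_{-\infty}(a,b)=\min\{a,b\}$; $M_t$ is extended by continuity to $a,b\ge0$ (so $M_t(a,b)=0$ if $t\le0$ and $ab=0$). For $-\infty\le t<\infty$ and $\tau\ge 0$ define $$J^B_{X,t}(\tau)=\sup\{M_t(\|x+\tau y\|,\|x-\tau y\|): x,y\in S_X,\ x\perp_B y\},\qquad C^B_t(X)=\sup_{0\le\tau\le1}\frac{J^B_{X,t}(\tau)^2}{1+\tau^2}.$$ Takahashi's unrestricted constants are $$J_{X,t}(\tau)=\sup\{M_t(\|x+\tau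 y\|,\|x-\tau y\|): x,y\in S_X\},\qquad C_t(X)=\sup_{0\le\tau\le1}\frac{J_{X,t}(\tau)^2}{1+\tau^2}.$$ *)

theory Defs
  imports "HOL-Analysis.Analysis"
begin

text \<open>The vector-space constant \<open>dim\<close> returns 0 on infinite-dimensional spaces, so lower
  bounds on the dimension are expressed through independent subsets.\<close>

definition dim_at_least :: "nat \<Rightarrow> 'a::real_vector set \<Rightarrow> bool" where
  "dim_at_least n V \<longleftrightarrow> (\<exists>B\<subseteq>V. independent B \<and> finite B \<and> card B = n)"

definition bj_orthogonal :: "'a::real_normed_vector \<Rightarrow> 'a \<Rightarrow> bool" (infix "\<bottom>\<^sub>B" 50) where
  "x \<bottom>\<^sub>B y \<longleftrightarrow> (\<forall>r::real. norm (x + r *\<^sub>R y) \<ge> norm x)"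

text \<open>The mean of order \<open>p\<close> on nonnegative arguments. The separate clause for \<open>p < 0\<close> is the
  continuous extension to \<open>a * b = 0\<close>; it is needed because \<open>0 powr p = 0\<close> also for
  negative \<open>p\<close>.\<close>

definition real_power_mean :: "real \<Rightarrow> real \<Rightarrow> real \<Rightarrow> real" where
  "real_power_mean p a b =
    (if p = 0 then sqrt (a * b)
     else if p < 0 \<and> a * b = 0 then 0
     else ((a powr p + b powr p) / 2) powr (1 / p))"

text \<open>Orders range over \<open>-\<infinity> \<le> t < \<infinity>\<close>; the value at \<open>\<infinity>\<close> only makes the function total.\<close>

definition power_mean :: "ereal \<Rightarrow> real \<Rightarrow> real \<Rightarrow> real" where
  "power_mean t a b =
    (if t = -\<infinity> then min a b
     else if t = \<infinity> then max a b
     else real_power_mean (real_of_ereal t) a b)"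

text \<open>The constants take the underlying space as a linear subspace \<open>X\<close> of the ambient type, with
  the inherited norm; the whole space is \<open>UNIV\<close>. For order \<open>t < \<infinity>\<close>, the sets under the real
  suprema are bounded above, since the means are at most \<open>1 + \<tau>\<close>, and they are nonempty when
  \<open>X\<close> has dimension at least 2.\<close>

definition JB :: "'a::real_normed_vector set \<Rightarrow> ereal \<Rightarrow> real \<Rightarrow> real" where
  "JB X t \<tau> =
    Sup {power_mean t (norm (x + \<tau> *\<^sub>R y)) (norm (x - \<tau> *\<^sub>R y)) | x y.
           x \<in> X \<inter> sphere 0 1 \<and> y \<in> X \<inter> sphere 0 1 \<and> x \<bottom>\<^sub>B y}"

definition CB :: "'a::real_normed_vector set \<Rightarrow> ereal \<Rightarrow> real" where
  "CB X t = (SUP \<tau>\<in>{0..1}. (JB X t \<tau>)\<^sup>2 / (1 + \<tau>\<^sup>2))"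

definition J_Takahashi :: "'a::real_normed_vector set \<Rightarrow> ereal \<Rightarrow> real \<Rightarrow> real" where
  "J_Takahashi X t \<tau> =
    Sup {power_mean t (norm (x + \<tau> *\<^sub>R y)) (norm (x - \<tau> *\<^sub>R y)) | x y.
           x \<in> X \<inter> sphere 0 1 \<and> y \<in> X \<inter> sphere 0 1}"

definition C_Takahashi :: "'a::real_normed_vector set \<Rightarrow> ereal \<Rightarrow> real" where
  "C_Takahashi X t = (SUP \<tau>\<in>{0..1}. (J_Takahashi X t \<tau>)\<^sup>2 / (1 + \<tau>\<^sup>2))"

end

theory Submission
  imports Defs
begin

text \<open>In two independent directions, moving along a line to its point of least norm produces a
  Birkhoff-James orthogonal pair, so the suprema defining the constants range over nonempty sets.
  Orthogonality keeps both norms \<open>\<parallel>x \<plusminus> \<tau> y\<parallel>\<close> between \<open>1\<close> and \<open>1 + \<tau>\<close>, hence also their means;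
  everything else is the power mean inequality and monotonicity of suprema.\<close>

section \<open>Power means of finite order, then of extended order\<close>

lemma real_power_mean_nonneg: "0 \<le> a \<Longrightarrow> 0 \<le> b \<Longrightarrow> 0 \<le> real_power_mean p a b"
  by (simp add: real_power_mean_def)

lemma real_power_mean_same: "0 \<le> a \<Longrightarrow> real_power_mean p a a = a"
  by (simp add: real_power_mean_def powr_powr)

text \<open>For negative \<open>p\<close> the inner power and the outer power \<open>1 / p\<close>
  both reverse the order, so the reversals cancel. If \<open>a * b = 0\<close> there, the left mean
  is 0 by the continuous extension, and nonnegativity of the right mean suffices.\<close>

lemma real_power_mean_mono:
  assumes "0 \<le> a" "a \<le> c" "0 \<le> b" "b \<le> d"
  shows "real_power_mean p a b \<le> real_power_mean p c d"
proof (cases p "0::real" rule: linorder_cases)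
  case less
  show ?thesis
  proof (cases "a * b = 0")
    case True
    then show ?thesis
      using less assms real_power_mean_nonneg[of c d p] by (simp add: real_power_mean_def)
  next
    case False
    then have pos: "0 < a" "0 < b" "0 < c" "0 < d" using assms by auto
    have "c powr p \<le> a powr p" "d powr p \<le> b powr p"
      using less assms pos by (auto intro!: powr_mono2')
    then have "(c powr p + d powr p) / 2 \<le> (a powr p + b powr p) / 2"
      by simp
    moreover have "0 < (c powr p + d powr p) / 2"
      using pos by (simp add: add_pos_pos)
    ultimately have "((a powr p + b powr p) / 2) powr (1 / p)
        \<le> ((c powr p + d powr p) / 2) powr (1 / p)"
      using less by (intro powr_mono2') auto
    then show ?thesis
      using less pos by (simp add: real_power_mean_def)
  qed
next
  case equal
  then show ?thesis using assms by (simp add: real_power_mean_def mult_mono)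
next
  case greater
  then have "a powr p \<le> c powr p" "b powr p \<le> d powr p"
    using assms by (auto intro!: powr_mono2)
  then have "((a powr p + b powr p) / 2) powr (1 / p)
      \<le> ((c powr p + d powr p) / 2) powr (1 / p)"
    using greater by (intro powr_mono2) auto
  then show ?thesis
    using greater by (simp add: real_power_mean_def)
qed

text \<open>Reflects negative orders to positive ones, so that comparing orders needs a direct
  argument only for nonnegative orders.\<close>

lemma real_power_mean_inverse:
  assumes "0 < a" "0 < b"
  shows "real_power_mean (- p) a b = inverse (real_power_mean p (inverse a) (inverse b))"
proof (cases "p = 0")
  case True
  then show ?thesis by (simp add: real_power_mean_def real_sqrt_inverse flip: inverse_mult_distrib)
next
  case False
  have "inverse x powr p = x powr - p" if "0 < x" for x :: real
    using that by (simp add: powr_minus inverse_powr)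
  then show ?thesis
    using assms False by (simp add: real_power_mean_def powr_minus[of _ "1 / p"])
qed

lemma real_power_mean_order_mono_pos:
  assumes "0 < a" "0 < b" "0 \<le> p" "p \<le> q"
  shows "real_power_mean p a b \<le> real_power_mean q a b"
proof -
  consider "p = q" | "p = 0" "0 < q" | "0 < p" "p < q"
    using assms by linarith
  then show ?thesis
  proof cases
    case 1
    then show ?thesis by simp
  next
    case 2
    \<comment> \<open>The geometric mean is rewritten so that the inequality becomes AM-GM for
      \<open>a powr q\<close> and \<open>b powr q\<close>, followed by the increasing power
      \<open>1 / q\<close>.\<close>
    have "sqrt (a * b) = sqrt (a powr q * b powr q) powr (1 / q)"
      using assms 2 by (simp add: powr_half_sqrt[symmetric] powr_mult powr_powr)
    also have "\<dots> \<le> ((a powr q + b powr q) / 2) powr (1 / q)"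
      using 2 by (intro powr_mono2 arith_geo_mean_sqrt) auto
    finally show ?thesis
      using 2 by (simp add: real_power_mean_def)
  next
    case 3
    \<comment> \<open>Since \<open>q / p\<close> exceeds 1, the function
      \<open>u powr (q / p)\<close> is convex; Jensen at the midpoint of \<open>?u\<close> and
      \<open>?v\<close> compares the two means after raising them to the power
      \<open>q\<close>.\<close>
    let ?u = "a powr p" and ?v = "b powr p"
    have "((1 - 1/2) *\<^sub>R ?u + (1/2) *\<^sub>R ?v) powr (q / p)
        \<le> (1 - 1/2) * ?u powr (q / p) + (1/2) * ?v powr (q / p)"
      using assms 3 by (intro convex_onD[OF powr_convex]) auto
    then have conv: "((?u + ?v) / 2) powr (q / p) \<le> (a powr q + b powr q) / 2"
      using 3 by (simp add: powr_powr field_simps)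
    have "((?u + ?v) / 2) powr (1 / p) = (((?u + ?v) / 2) powr (q / p)) powr (1 / q)"
      using 3 by (simp add: powr_powr)
    also have "\<dots> \<le> ((a powr q + b powr q) / 2) powr (1 / q)"
      using 3 conv by (intro powr_mono2) auto
    finally show ?thesis
      using 3 by (simp add: real_power_mean_def)
  qed
qed

text \<open>Nonpositive orders reduce to nonnegative ones through reciprocals. Orders of opposite
  sign are compared through the geometric mean at order 0.\<close>

lemma real_power_mean_order_mono:
  assumes "0 < a" "0 < b" "p \<le> q"
  shows "real_power_mean p a b \<le> real_power_mean q a b"
proof -
  have neg: "real_power_mean r a b \<le> real_power_mean s a b" if "r \<le> s" "s \<le> 0" for r s
  proof -
    let ?M = "\<lambda>p. real_power_mean p (inverse a) (inverse b)"
    have "?M (- s) \<le> ?M (- r)"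
      using assms that by (intro real_power_mean_order_mono_pos) auto
    \<comment> \<open>Inverting the inequality needs a positive smaller side; the mean dominates
      that of two copies of the smaller argument, which is this argument itself.\<close>
    moreover have "0 < ?M (- s)"
    proof -
      have "min (inverse a) (inverse b) \<le> ?M (- s)"
        using assms real_power_mean_mono[of "min (inverse a) (inverse b)" "inverse a"
            "min (inverse a) (inverse b)" "inverse b" "- s"]
        by (simp add: real_power_mean_same)
      then show ?thesis using assms by (smt (verit) positive_imp_inverse_positive)
    qed
    ultimately show ?thesis
      using assms real_power_mean_inverse[of a b "- r"] real_power_mean_inverse[of a b "- s"]
      by (simp add: le_imp_inverse_le)
  qed
  show ?thesis
  proof (cases "0 \<le> p \<or> q \<le> 0")
    case True
    then show ?thesis using assms neg real_power_mean_order_mono_pos by blast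
  next
    case False
    then show ?thesis
      using assms neg[of p 0] real_power_mean_order_mono_pos[of a b 0 q] by linarith
  qed
qed

text \<open>By monotonicity in the arguments, the mean is compared with the mean of two copies of
  \<open>m\<close>, which equals \<open>m\<close>.\<close>

lemma power_mean_le:
  assumes "0 \<le> a" "a \<le> m" "0 \<le> b" "b \<le> m"
  shows "power_mean t a b \<le> m"
  using assms real_power_mean_mono[of a m b m "real_of_ereal t"]
  by (auto simp: power_mean_def real_power_mean_same)

lemma power_mean_ge:
  assumes "0 \<le> m" "m \<le> a" "m \<le> b"
  shows "m \<le> power_mean t a b"
  using assms real_power_mean_mono[of m a m b "real_of_ereal t"]
  by (auto simp: power_mean_def real_power_mean_same)

lemma power_mean_order_mono:
  assumes "0 < a" "0 < b" "s \<le> t"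
  shows "power_mean s a b \<le> power_mean t a b"
proof -
  consider "s = -\<infinity>" | "t = \<infinity>" | p q where "s = ereal p" "t = ereal q" "p \<le> q"
    using assms(3) by (cases s; cases t) auto
  then show ?thesis
  proof cases
    case 1
    then show ?thesis using assms power_mean_ge[of "min a b" a b t] by (simp add: power_mean_def)
  next
    case 2
    then show ?thesis using assms power_mean_le[of a "max a b" b s] by (simp add: power_mean_def)
  next
    case 3
    then show ?thesis using assms real_power_mean_order_mono by (simp add: power_mean_def)
  qed
qed

section \<open>Norm minimization on lines and existence of orthogonal unit pairs\<close>

lemma exists_min_norm_on_line:
  fixes x z :: "'a::real_normed_vector"
  assumes "z \<noteq> 0"
  obtains l where "\<And>r. norm (x + l *\<^sub>R z) \<le> norm (x + r *\<^sub>R z)"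
proof -
  \<comment> \<open>Compactness gives a minimizer on \<open>{-R..R}\<close>. The radius is chosen so
    that beyond it the reverse triangle inequality yields a norm of at least
    \<open>2 * norm x - norm x\<close>, which is the value at \<open>r = 0\<close>; so the minimizer
    is global.\<close>
  define R where "R = 2 * norm x / norm z"
  have "R \<ge> 0" by (simp add: R_def)
  have "continuous_on {-R..R} (\<lambda>r. norm (x + r *\<^sub>R z))"
    by (intro continuous_intros)
  then obtain l where l: "\<And>r. r \<in> {-R..R} \<Longrightarrow> norm (x + l *\<^sub>R z) \<le> norm (x + r *\<^sub>R z)"
    using continuous_attains_inf[of "{-R..R}"] \<open>R \<ge> 0\<close> by (metis atLeastAtMost_iff compact_Icc
      emptyE neg_le_0_iff_le)
  have "norm (x + l *\<^sub>R z) \<le> norm (x + r *\<^sub>R z)" if "r \<notin> {-R..R}" for r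
  proof -
    have "norm x * 2 = R * norm z" using assms by (simp add: R_def)
    also have "\<dots> \<le> \<bar>r\<bar> * norm z"
      using that by (intro mult_right_mono) auto
    also have "\<dots> \<le> norm (x + r *\<^sub>R z) + norm x"
      using norm_triangle_ineq4[of "x + r *\<^sub>R z" x] by simp
    finally show ?thesis using l[of 0] \<open>R \<ge> 0\<close> by simp
  qed
  with l that show ?thesis by blast
qed

text \<open>Allows normalizing an orthogonal pair. For nonzero \<open>a\<close>, factor out
  \<open>\<bar>a\<bar>\<close> and use the hypothesis at the coefficient
  \<open>r * b / a\<close>.\<close>

lemma bj_orthogonal_scaleR:
  assumes "x \<bottom>\<^sub>B y"
  shows "(a *\<^sub>R x) \<bottom>\<^sub>B (b *\<^sub>R y)"
proof (cases "a = 0")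
  case False
  have "norm (a *\<^sub>R x) \<le> norm (a *\<^sub>R x + r *\<^sub>R b *\<^sub>R y)" for r
  proof -
    have "\<bar>a\<bar> * norm x \<le> \<bar>a\<bar> * norm (x + (r * b / a) *\<^sub>R y)"
      using assms by (intro mult_left_mono) (auto simp: bj_orthogonal_def)
    also have "\<dots> = norm (a *\<^sub>R (x + (r * b / a) *\<^sub>R y))" by simp
    also have "a *\<^sub>R (x + (r * b / a) *\<^sub>R y) = a *\<^sub>R x + r *\<^sub>R b *\<^sub>R y"
      using False by (simp add: scaleR_right_distrib)
    finally show ?thesis by simp
  qed
  then show ?thesis by (simp add: bj_orthogonal_def)
qed (simp add: bj_orthogonal_def)

lemma exists_bj_orthogonal_unit:
  fixes X :: "'a::real_normed_vector set"
  assumes "subspace X" "dim_at_least 2 X"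
  obtains x y where "x \<in> X \<inter> sphere 0 1" "y \<in> X \<inter> sphere 0 1" "x \<bottom>\<^sub>B y"
proof -
  obtain u z where uz: "u \<in> X" "z \<in> X" "independent {u, z}" "u \<noteq> z"
    using assms(2) unfolding dim_at_least_def card_2_iff by (metis insert_subset)
  have "z \<noteq> 0" using uz dependent_zero by blast
  then obtain l where l: "\<And>r. norm (u + l *\<^sub>R z) \<le> norm (u + r *\<^sub>R z)"
    using exists_min_norm_on_line by blast
  define w where "w = u + l *\<^sub>R z"
  have "w \<noteq> 0"
  proof
    assume "w = 0"
    then have "u = (- l) *\<^sub>R z" by (simp add: w_def eq_neg_iff_add_eq_0)
    then have "u \<in> span {z}" by (metis span_base span_scale singletonI)
    then show False using uz by (simp add: independent_insert)
  qed
  \<comment> \<open>Shifting the parameter by \<open>l\<close> moves the minimum to the origin: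
    \<open>w + r *\<^sub>R z\<close> is \<open>u + (l + r) *\<^sub>R z\<close>.\<close>
  have "w \<bottom>\<^sub>B z"
    using l[of "l + _"] by (simp add: bj_orthogonal_def w_def scaleR_left_distrib add.assoc)
  show ?thesis
  proof
    show "inverse (norm w) *\<^sub>R w \<in> X \<inter> sphere 0 1"
      using assms uz \<open>w \<noteq> 0\<close> by (simp add: w_def subspace_add subspace_scale)
    show "inverse (norm z) *\<^sub>R z \<in> X \<inter> sphere 0 1"
      using assms uz \<open>z \<noteq> 0\<close> by (simp add: subspace_scale)
    show "(inverse (norm w) *\<^sub>R w) \<bottom>\<^sub>B (inverse (norm z) *\<^sub>R z)"
      using \<open>w \<bottom>\<^sub>B z\<close> by (rule bj_orthogonal_scaleR)
  qed
qed

lemma bj_orthogonal_norm_ge: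
  assumes "x \<bottom>\<^sub>B y"
  shows "norm x \<le> norm (x + r *\<^sub>R y)" "norm x \<le> norm (x - r *\<^sub>R y)"
  using assms unfolding bj_orthogonal_def
  by (blast, metis add_uminus_conv_diff scaleR_minus_left)

section \<open>The suprema at a fixed \<open>\<tau>\<close>\<close>

lemma power_mean_norm_le:
  assumes "x \<in> sphere 0 1" "y \<in> sphere 0 1" "0 \<le> \<tau>"
  shows "power_mean t (norm (x + \<tau> *\<^sub>R y)) (norm (x - \<tau> *\<^sub>R y)) \<le> 1 + \<tau>"
  using assms norm_triangle_ineq[of x "\<tau> *\<^sub>R y"] norm_triangle_ineq4[of x "\<tau> *\<^sub>R y"]
  by (intro power_mean_le) auto

lemma JB_upper:
  assumes "x \<in> X \<inter> sphere 0 1" "y \<in> X \<inter> sphere 0 1" "x \<bottom>\<^sub>B y" "0 \<le> \<tau>"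
  shows "power_mean t (norm (x + \<tau> *\<^sub>R y)) (norm (x - \<tau> *\<^sub>R y)) \<le> JB X t \<tau>"
  unfolding JB_def using assms
  by (intro cSup_upper bdd_aboveI[of _ "1 + \<tau>"]) (auto intro: power_mean_norm_le)

text \<open>The dimension hypothesis makes the set under the supremum nonempty; on the empty set a
  real \<open>Sup\<close> would carry no information.\<close>

lemma JB_least:
  assumes "subspace X" "dim_at_least 2 X"
    and "\<And>x y. x \<in> X \<inter> sphere 0 1 \<Longrightarrow> y \<in> X \<inter> sphere 0 1 \<Longrightarrow> x \<bottom>\<^sub>B y \<Longrightarrow>
      power_mean t (norm (x + \<tau> *\<^sub>R y)) (norm (x - \<tau> *\<^sub>R y)) \<le> c"
  shows "JB X t \<tau> \<le> c"
proof -
  obtain x y where "x \<in> X \<inter> sphere 0 1" "y \<in> X \<inter> sphere 0 1" "x \<bottom>\<^sub>B y"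
    using exists_bj_orthogonal_unit assms(1,2) by blast
  then show ?thesis
    unfolding JB_def using assms(3) by (intro cSup_least) blast+
qed

lemma JB_bounds:
  assumes "subspace X" "dim_at_least 2 X" "0 \<le> \<tau>"
  shows "1 \<le> JB X t \<tau>" "JB X t \<tau> \<le> 1 + \<tau>"
proof -
  obtain x y where xy: "x \<in> X \<inter> sphere 0 1" "y \<in> X \<inter> sphere 0 1" "x \<bottom>\<^sub>B y"
    using exists_bj_orthogonal_unit assms by blast
  have "1 \<le> power_mean t (norm (x + \<tau> *\<^sub>R y)) (norm (x - \<tau> *\<^sub>R y))"
    using xy bj_orthogonal_norm_ge[of x y \<tau>] by (intro power_mean_ge) auto
  also have "\<dots> \<le> JB X t \<tau>" using xy assms by (intro JB_upper)
  finally show "1 \<le> JB X t \<tau>" .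
  show "JB X t \<tau> \<le> 1 + \<tau>"
    using assms by (intro JB_least power_mean_norm_le) auto
qed

lemma JB_order_mono:
  assumes "subspace X" "dim_at_least 2 X" "0 \<le> \<tau>" "s \<le> t"
  shows "JB X s \<tau> \<le> JB X t \<tau>"
proof (rule JB_least[OF assms(1,2)])
  fix x y :: 'a
  assume xy: "x \<in> X \<inter> sphere 0 1" "y \<in> X \<inter> sphere 0 1" "x \<bottom>\<^sub>B y"
  \<comment> \<open>Comparing orders requires positive arguments; orthogonality supplies this, as
    both norms are at least \<open>norm x = 1\<close>.\<close>
  have "power_mean s (norm (x + \<tau> *\<^sub>R y)) (norm (x - \<tau> *\<^sub>R y))
      \<le> power_mean t (norm (x + \<tau> *\<^sub>R y)) (norm (x - \<tau> *\<^sub>R y))"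
    using xy assms(4) bj_orthogonal_norm_ge[of x y \<tau>] by (intro power_mean_order_mono) auto
  also have "\<dots> \<le> JB X t \<tau>" using xy assms(3) by (intro JB_upper)
  finally show "power_mean s (norm (x + \<tau> *\<^sub>R y)) (norm (x - \<tau> *\<^sub>R y)) \<le> JB X t \<tau>" .
qed

text \<open>Orthogonality refers only to the norm, so every admissible pair of \<open>Y\<close> is
  also admissible in \<open>X\<close>.\<close>

lemma JB_subspace_mono:
  assumes "subspace Y" "dim_at_least 2 Y" "Y \<subseteq> X" "0 \<le> \<tau>"
  shows "JB Y t \<tau> \<le> JB X t \<tau>"
  using assms by (intro JB_least JB_upper) auto

lemma J_Takahashi_upper:
  assumes "x \<in> X \<inter> sphere 0 1" "y \<in> X \<inter> sphere 0 1" "0 \<le> \<tau>"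
  shows "power_mean t (norm (x + \<tau> *\<^sub>R y)) (norm (x - \<tau> *\<^sub>R y)) \<le> J_Takahashi X t \<tau>"
  unfolding J_Takahashi_def using assms
  by (intro cSup_upper bdd_aboveI[of _ "1 + \<tau>"]) (auto intro: power_mean_norm_le)

lemma JB_le_J_Takahashi:
  assumes "subspace X" "dim_at_least 2 X" "0 \<le> \<tau>"
  shows "JB X t \<tau> \<le> J_Takahashi X t \<tau>"
  using assms by (intro JB_least J_Takahashi_upper) auto

lemma J_Takahashi_le:
  assumes "subspace X" "dim_at_least 2 X" "0 \<le> \<tau>"
  shows "J_Takahashi X t \<tau> \<le> 1 + \<tau>"
proof -
  obtain x y where "x \<in> X \<inter> sphere 0 1" "y \<in> X \<inter> sphere 0 1"
    using exists_bj_orthogonal_unit assms by blast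
  then show ?thesis
    unfolding J_Takahashi_def using assms(3)
    by (intro cSup_least) (auto intro: power_mean_norm_le)
qed

section \<open>The suprema over \<open>\<tau>\<close> in the unit interval\<close>

lemma square_ratio_le_2:
  fixes j \<tau> :: real
  assumes "0 \<le> j" "j \<le> 1 + \<tau>"
  shows "j\<^sup>2 / (1 + \<tau>\<^sup>2) \<le> 2"
proof -
  have "j\<^sup>2 \<le> (1 + \<tau>)\<^sup>2" using assms by (intro power_mono)
  \<comment> \<open>The difference of the two sides is the square of
    \<open>1 - \<tau>\<close>.\<close>
  also have "\<dots> \<le> 2 * (1 + \<tau>\<^sup>2)"
    using zero_le_power2[of "1 - \<tau>"] by (simp add: power2_eq_square algebra_simps)
  finally show ?thesis by (simp add: divide_le_eq add_pos_nonneg)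
qed

text \<open>Common to the comparisons of order, of subspaces and with Takahashi's constant.
  Nonnegativity of \<open>f\<close> permits squaring, and the bound on \<open>g\<close> keeps the
  right supremum finite.\<close>

lemma SUP_square_ratio_mono:
  fixes f g :: "real \<Rightarrow> real"
  assumes "\<And>\<tau>. \<tau> \<in> {0..1} \<Longrightarrow> 0 \<le> f \<tau> \<and> f \<tau> \<le> g \<tau> \<and> g \<tau> \<le> 1 + \<tau>"
  shows "(SUP \<tau>\<in>{0..1}. (f \<tau>)\<^sup>2 / (1 + \<tau>\<^sup>2)) \<le> (SUP \<tau>\<in>{0..1}. (g \<tau>)\<^sup>2 / (1 + \<tau>\<^sup>2))"
proof (rule cSUP_mono)
  show "bdd_above ((\<lambda>\<tau>. (g \<tau>)\<^sup>2 / (1 + \<tau>\<^sup>2)) ` {0..1})"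
    using assms by (intro bdd_aboveI2[of _ _ 2] square_ratio_le_2) (auto intro: order_trans)
  show "\<exists>\<sigma>\<in>{0..1}. (f \<tau>)\<^sup>2 / (1 + \<tau>\<^sup>2) \<le> (g \<sigma>)\<^sup>2 / (1 + \<sigma>\<^sup>2)" if "\<tau> \<in> {0..1}" for \<tau>
    using that assms by (intro bexI[of _ \<tau>] divide_right_mono power_mono) auto
qed simp

lemma CB_bounds:
  assumes "subspace X" "dim_at_least 2 X"
  shows "1 \<le> CB X t" "CB X t \<le> 2"
proof -
  have le2: "(JB X t \<tau>)\<^sup>2 / (1 + \<tau>\<^sup>2) \<le> 2" if "\<tau> \<in> {0..1}" for \<tau>
    using that JB_bounds[OF assms, of \<tau> t] by (intro square_ratio_le_2) auto
  then show "CB X t \<le> 2"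
    unfolding CB_def by (intro cSUP_least) auto
  \<comment> \<open>The lower bound is already witnessed by the term at
    \<open>\<tau> = 0\<close>.\<close>
  have "1 \<le> (JB X t 0)\<^sup>2 / (1 + 0\<^sup>2)"
    using JB_bounds[OF assms, of 0 t] by simp
  also have "\<dots> \<le> CB X t"
    unfolding CB_def using le2 by (intro cSUP_upper bdd_aboveI2[of _ _ 2]) auto
  finally show "1 \<le> CB X t" .
qed

lemma CB_order_mono:
  assumes "subspace X" "dim_at_least 2 X" "s \<le> t"
  shows "CB X s \<le> CB X t"
  unfolding CB_def
  using JB_bounds[OF assms(1,2)] JB_order_mono[OF assms(1,2) _ assms(3)]
  by (intro SUP_square_ratio_mono) (auto intro: order_trans[OF zero_le_one])

lemma CB_subspace_mono:
  assumes "subspace Y" "dim_at_least 2 Y" "subspace X" "Y \<subseteq> X"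
  shows "CB Y t \<le> CB X t"
proof -
  have "dim_at_least 2 X"
    using assms(2,4) unfolding dim_at_least_def by blast
  then show ?thesis
    unfolding CB_def
    using JB_bounds(1)[OF assms(1,2)] JB_bounds(2)[OF assms(3)] JB_subspace_mono[OF assms(1,2,4)]
    by (intro SUP_square_ratio_mono) (auto intro: order_trans[OF zero_le_one])
qed

lemma CB_le_C_Takahashi:
  assumes "subspace X" "dim_at_least 2 X"
  shows "CB X t \<le> C_Takahashi X t"
  unfolding CB_def C_Takahashi_def
  using JB_bounds(1)[OF assms] JB_le_J_Takahashi[OF assms] J_Takahashi_le[OF assms]
  by (intro SUP_square_ratio_mono) (auto intro: order_trans[OF zero_le_one])

theorem proposition2:
  fixes t :: ereal
  assumes "dim_at_least 2 (UNIV :: 'a::banach set)"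
    and "t < \<infinity>"
  shows "(1 \<le> CB (UNIV :: 'a set) t \<and> CB (UNIV :: 'a set) t \<le> 2) \<and>
    (JB (UNIV :: 'a set) t 0 = 1 \<and>
      (\<forall>\<tau>\<in>{0..1}. 1 \<le> JB (UNIV :: 'a set) t \<tau> \<and> JB (UNIV :: 'a set) t \<tau> \<le> 1 + \<tau>)) \<and>
    (\<forall>s\<le>t. (\<forall>\<tau>\<ge>0. JB (UNIV :: 'a set) s \<tau> \<le> JB (UNIV :: 'a set) t \<tau>) \<and>
      CB (UNIV :: 'a set) s \<le> CB (UNIV :: 'a set) t) \<and>
    (\<forall>Y :: 'a set. subspace Y \<and> closed Y \<and> dim_at_least 2 Y \<longrightarrow>
      CB Y t \<le> CB (UNIV :: 'a set) t) \<and>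
    CB (UNIV :: 'a set) t \<le> C_Takahashi (UNIV :: 'a set) t"
proof -
  note UNIV_dim = subspace_UNIV assms(1)
  \<comment> \<open>At \<open>\<tau> = 0\<close> the bounds 1 and \<open>1 + \<tau>\<close>
    coincide.\<close>
  have "JB (UNIV :: 'a set) t 0 = 1"
    using JB_bounds[OF UNIV_dim, of 0 t] by simp
  then show ?thesis
    by (auto intro: JB_bounds[OF UNIV_dim] JB_order_mono[OF UNIV_dim] CB_bounds[OF UNIV_dim]
        CB_order_mono[OF UNIV_dim] CB_subspace_mono CB_le_C_Takahashi[OF UNIV_dim])
qed

end
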